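(* Let $\mathcal{E}=\{e_1,\dots,e_E\}$ be a set of environments with $E\le d_e$ whose environmental means $\{\boldsymbol\mu_e\}_{e\in\mathcal{E}}\subset\mathbb{R}^{d_e}$ are linearly independent. Let $\mathbf{p}\in\mathbb{R}^{d_e}$ be a unit-norm vector and $\beta>0$ a scalar such that $\mathbf{p}^\top\boldsymbol\mu_e/\sigma_e^2=\beta$ for all $e\in\mathcal{E}$, and consider the corresponding invariant classifier (see context). Consider an out-of-distribution input containing the environmental feature, i.e. an input with feature vector $\Phi_{\text{out}}=M_{\text{inv}}\mathbf{z}_{\text{out}}+M_e\mathbf{z}_e$, where $\mathbf{z}_{\text{out}}\in\mathbb{R}^s$ satisfies $\mathbf{z}_{\text{out}}\perp\boldsymbol\mu_{\text{inv}}$ and $\mathbf{z}_e\in\mathbb{R}^{d_e}$. Then the posterior probability assigned to this input by the invariant classifier is $$p(y=1\mid\Phi_{\text{out}})=\sigma\!\left(2\,\mathbf{p}^\top\mathbf{z}_e\,\beta+\log\frac{\eta}{1-\eta}\right),$$ where $\sigma(t)=1/(1+e^{-t})$ is the logistic function. Consequently, for every $c$ with $0<c<1$ there exists such a $\Phi_{\text{out}}$, with $\mathbf{z}_e$ satisfying $$\mathbf{p}^\top\mathbf{z}_e=\frac{1}{2\beta}\log\frac{c(1-\eta)}{\eta(1-c)},$$ for which $p(y=1\mid\Phi_{\text{out}})=c$.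
   Context: Data model: the label $y\in\{-1,1\}$ satisfies $P(y=1)=\eta$ with $\eta\in(0,1)$ fixed. In environment $e\in\mathcal{E}$, given $y$, the invariant features $\mathbf{z}_{\text{inv}}\in\mathbb{R}^s$ and the environmental features $\mathbf{z}_e\in\mathbb{R}^{d_e}$ are independent with $$\mathbf{z}_{\text{inv}}\sim\mathcal{N}(y\,\boldsymbol\mu_{\text{inv}},\sigma_{\text{inv}}^2 I),\qquad \mathbf{z}_e\sim\mathcal{N}(y\,\boldsymbol\mu_e,\sigma_e^2 I),$$ where $\boldsymbol\mu_{\text{inv}}\in\mathbb{R}^s$ and $\sigma_{\text{inv}}>0$ do not depend on the environment, while $\boldsymbol\mu_e\in\mathbb{R}^{d_e}$ and $\sigma_e>0$ may depend on $e$. Feature map: $M_{\text{inv}}=\begin{bmatrix}I_{s\times s}\\0_{1\times s}\end{bmatrix}$ and $M_e=\begin{bmatrix}0_{s\times d_e}\\\mathbf{p}^\top\end{bmatrix}$, so in-distribution features are $\begin{bmatrix}\mathbf{z}_{\text{inv}}\\\mathbf{p}^\top\mathbf{z}_e\end{bmatrix}\in\mathbb{R}^{s+1}$ and the OOD feature is $\Phi_{\text{out}}=\begin{bmatrix}\mathbf{z}_{\text{out}}\\\mathbf{p}^\top\mathbf{z}_e\end{bmatrix}$. Invariant classifier: it has weight vector $\hat w=\begin{bmatrix}2\boldsymbol\mu_{\text{inv}}/\sigma_{\text{inv}}^2\\2\beta\end{bmatrix}\in\mathbb{R}^{s+1}$ (the same for every environment) and constant term $\log\frac{\eta}{1-\eta}$;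 the posterior probability it assigns to a feature vector $\phi\in\mathbb{R}^{s+1}$ is $p(y=1\mid\phi)=\sigma\big(\hat w^\top\phi+\log\frac{\eta}{1-\eta}\big)$. *)

theory Defs
  imports "HOL-Probability.Probability"
begin

definition iso_normal_density :: "real ^ 'n \<Rightarrow> real \<Rightarrow> real ^ 'n \<Rightarrow> real" where
  "iso_normal_density \<mu> \<sigma> x = (\<Prod>i\<in>UNIV. normal_density (\<mu> $ i) \<sigma> (x $ i))"

text \<open>
  The data of one environment on a probability space \<open>M\<close>: label \<open>y\<close>, invariant features \<open>zi\<close>,
  environmental features \<open>ze\<close>. Both values of \<open>y\<close> have positive probability when
  \<open>0 < \<eta> < 1\<close>, so conditioning on \<open>y = v\<close> is the elementary conditional measure,
  which is \<^const>\<open>uniform_measure\<close> of \<open>M\<close> on the event \<open>y = v\<close>.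
  Independence of \<open>zi\<close> and \<open>ze\<close> is independence of the generated sigma-algebras, because
  \<open>prob_space.indep_var\<close> requires both variables to take values in the same type.
\<close>

definition cond_label :: "'w measure \<Rightarrow> ('w \<Rightarrow> real) \<Rightarrow> real \<Rightarrow> 'w measure" where
  "cond_label M y v = uniform_measure M {\<omega> \<in> space M. y \<omega> = v}"

definition environment_model ::
  "real \<Rightarrow> real ^ 's \<Rightarrow> real \<Rightarrow> real ^ 'd \<Rightarrow> real \<Rightarrow>
   'w measure \<Rightarrow> ('w \<Rightarrow> real) \<Rightarrow> ('w \<Rightarrow> real ^ 's) \<Rightarrow> ('w \<Rightarrow> real ^ 'd) \<Rightarrow> bool" where
  "environment_model \<eta> \<mu>i \<sigma>i \<mu>e \<sigma>e M y zi ze \<longleftrightarrow>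
     prob_space M \<and>
     y \<in> borel_measurable M \<and> (\<forall>\<omega>\<in>space M. y \<omega> \<in> {-1, 1}) \<and>
     measure M {\<omega> \<in> space M. y \<omega> = 1} = \<eta> \<and>
     (\<forall>v\<in>{-1, 1}.
        prob_space.indep_set (cond_label M y v)
          (sets (vimage_algebra (space M) zi borel)) (sets (vimage_algebra (space M) ze borel)) \<and>
        distributed (cond_label M y v) lborel zi (\<lambda>x. ennreal (iso_normal_density (v *\<^sub>R \<mu>i) \<sigma>i x)) \<and>
        distributed (cond_label M y v) lborel ze (\<lambda>x. ennreal (iso_normal_density (v *\<^sub>R \<mu>e) \<sigma>e x)))"

text \<open>
  Feature vectors in dimension \<open>s + 1\<close> are indexed by \<^typ>\<open>'s + unit\<close>: the indices \<open>Inl k\<close> are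
  the first \<open>s\<close> coordinates and \<open>Inr ()\<close> is the last one.
\<close>

definition M_inv :: "real ^ 's ^ ('s + unit)" where
  "M_inv = (\<chi> i j. case i of Inl k \<Rightarrow> (if k = j then 1 else 0) | Inr _ \<Rightarrow> 0)"

definition M_env :: "real ^ 'd \<Rightarrow> real ^ 'd ^ ('s::finite + unit)" where
  "M_env p = (\<chi> i j. case i of Inl _ \<Rightarrow> 0 | Inr _ \<Rightarrow> p $ j)"

definition feature :: "real ^ 'd \<Rightarrow> real ^ 's \<Rightarrow> real ^ 'd \<Rightarrow> real ^ ('s + unit)" where
  "feature p z ze = M_inv *v z + M_env p *v ze"

definition logistic :: "real \<Rightarrow> real" where
  "logistic t = 1 / (1 + exp (- t))"

definition inv_weight :: "real ^ 's \<Rightarrow> real \<Rightarrow> real \<Rightarrow> real ^ ('s + unit)" where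
  "inv_weight \<mu>i \<sigma>i \<beta> = (\<chi> i. case i of Inl k \<Rightarrow> 2 * \<mu>i $ k / \<sigma>i\<^sup>2 | Inr _ \<Rightarrow> 2 * \<beta>)"

definition inv_posterior ::
  "real \<Rightarrow> real ^ 's \<Rightarrow> real \<Rightarrow> real \<Rightarrow> real ^ ('s + unit) \<Rightarrow> real" where
  "inv_posterior \<eta> \<mu>i \<sigma>i \<beta> \<phi> = logistic (inv_weight \<mu>i \<sigma>i \<beta> \<bullet> \<phi> + ln (\<eta> / (1 - \<eta>)))"

end

theory Submission
  imports Defs
begin

text \<open>The invariant and environmental parts of a feature vector occupy disjoint coordinates,
  so the linear score splits into a multiple of \<open>z \<bullet> \<mu>i\<close> and the term
  \<open>2 * (p \<bullet> w) * \<beta>\<close> (\<open>inner_inv_weight_feature\<close>).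
  Orthogonality kills the first, leaving a score governed by \<open>p \<bullet> w\<close> alone.
  Since \<open>p\<close> is a unit vector, multiples of \<open>p\<close> give this projection any
  real value, and since the logistic function inverts the log-odds (\<open>logistic_logit\<close>),
  any posterior \<open>c\<close> strictly between 0 and 1 is reached by solving a linear
  equation.\<close>

lemma feature_nth [simp]:
  "feature p z w $ Inl k = z $ k"
  "feature p z w $ Inr u = p \<bullet> w"
  \<comment> \<open>Rows of \<open>M_inv\<close> are Kronecker deltas; moving the product into the
    branches of the \<open>if\<close> collapses each sum to one term.\<close>
  by (simp_all add: feature_def M_inv_def M_env_def matrix_vector_mult_def inner_vec_def
      if_distrib [of "\<lambda>x. x * _"] cong: if_cong)

lemma inner_sum_index:
  fixes a b :: "real ^ ('s::finite + unit)"
  shows "a \<bullet> b = (\<Sum>k\<in>UNIV. a $ Inl k * b $ Inl k) + a $ Inr () * b $ Inr ()"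
  by (simp add: inner_vec_def UNIV_Plus_UNIV [symmetric] sum.Plus UNIV_unit)

text \<open>Isolating \<open>z \<bullet> \<mu>i\<close> as a factor is what allows orthogonality to
  remove the invariant block.\<close>

lemma inner_inv_weight_feature:
  "inv_weight \<mu>i \<sigma>i \<beta> \<bullet> feature p z w = 2 / \<sigma>i\<^sup>2 * (z \<bullet> \<mu>i) + 2 * (p \<bullet> w) * \<beta>"
proof -
  have "(\<Sum>k\<in>UNIV. 2 * \<mu>i $ k / \<sigma>i\<^sup>2 * z $ k) = 2 / \<sigma>i\<^sup>2 * (z \<bullet> \<mu>i)"
    by (simp add: inner_vec_def sum_distrib_left mult_ac)
  then show ?thesis
    by (simp add: inner_sum_index inv_weight_def)
qed

lemma inv_posterior_feature_orthogonal:
  assumes "orthogonal z \<mu>i"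
  shows "inv_posterior \<eta> \<mu>i \<sigma>i \<beta> (feature p z w) =
    logistic (2 * (p \<bullet> w) * \<beta> + ln (\<eta> / (1 - \<eta>)))"
  using assms by (simp add: inv_posterior_def inner_inv_weight_feature orthogonal_def)

text \<open>Turns the demand for posterior \<open>c\<close> into an equation between
  log-odds.\<close>

lemma logistic_logit:
  assumes "0 < c" "c < 1"
  shows "logistic (ln (c / (1 - c))) = c"
proof -
  have "exp (- ln (c / (1 - c))) = (1 - c) / c"
    using assms by (simp add: exp_minus)
  then have "logistic (ln (c / (1 - c))) = 1 / (1 + (1 - c) / c)"
    by (simp only: logistic_def)
  also have "\<dots> = c"
    using assms by (simp add: field_simps)
  finally show ?thesis .
qed

theorem theorem1:
  fixes \<E> :: "'e set"
    and \<eta> \<sigma>i \<beta> :: real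
    and \<mu>i :: "real ^ 's"
    and \<mu> :: "'e \<Rightarrow> real ^ 'd" and \<sigma> :: "'e \<Rightarrow> real"
    and M :: "'e \<Rightarrow> 'w measure"
    and y :: "'e \<Rightarrow> 'w \<Rightarrow> real"
    and zi :: "'e \<Rightarrow> 'w \<Rightarrow> real ^ 's"
    and ze :: "'e \<Rightarrow> 'w \<Rightarrow> real ^ 'd"
    and p :: "real ^ 'd"
  assumes eta: "0 < \<eta>" "\<eta> < 1"
    and sigma_inv: "0 < \<sigma>i"
    and sigma_env: "\<forall>e\<in>\<E>. 0 < \<sigma> e"
    and model: "\<forall>e\<in>\<E>. environment_model \<eta> \<mu>i \<sigma>i (\<mu> e) (\<sigma> e) (M e) (y e) (zi e) (ze e)"
    and envs: "finite \<E>" "card \<E> \<le> CARD('d)"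
    and lin_indep: "inj_on \<mu> \<E>" "independent (\<mu> ` \<E>)"
    and p_unit: "norm p = 1"
    and beta_pos: "0 < \<beta>"
    and p_beta: "\<forall>e\<in>\<E>. (p \<bullet> \<mu> e) / (\<sigma> e)\<^sup>2 = \<beta>"
  shows "(\<forall>z_out z_e. orthogonal z_out \<mu>i \<longrightarrow>
            inv_posterior \<eta> \<mu>i \<sigma>i \<beta> (feature p z_out z_e) =
              logistic (2 * (p \<bullet> z_e) * \<beta> + ln (\<eta> / (1 - \<eta>)))) \<and>
         (\<forall>c. 0 < c \<and> c < 1 \<longrightarrow>
            (\<exists>z_out z_e. orthogonal z_out \<mu>i \<and>
               p \<bullet> z_e = 1 / (2 * \<beta>) * ln (c * (1 - \<eta>) / (\<eta> * (1 - c))) \<and>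
               inv_posterior \<eta> \<mu>i \<sigma>i \<beta> (feature p z_out z_e) = c))"
proof (intro conjI allI impI)
  fix z_out :: "real ^ 's" and z_e :: "real ^ 'd"
  assume "orthogonal z_out \<mu>i"
  then show "inv_posterior \<eta> \<mu>i \<sigma>i \<beta> (feature p z_out z_e) =
      logistic (2 * (p \<bullet> z_e) * \<beta> + ln (\<eta> / (1 - \<eta>)))"
    by (rule inv_posterior_feature_orthogonal)
next
  fix c :: real
  assume c: "0 < c \<and> c < 1"
  \<comment> \<open>The solution of \<open>2 * t * \<beta> + ln (\<eta> / (1 - \<eta>)) = ln (c / (1
    - c))\<close>: the log of the odds ratio of \<open>c\<close> to \<eta>, divided by
    \<open>2 * \<beta>\<close>.\<close>
  define t where "t = 1 / (2 * \<beta>) * ln (c * (1 - \<eta>) / (\<eta> * (1 - c)))"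
  have "p \<bullet> p = 1"
    using p_unit by (simp add: dot_square_norm)
  then have pt: "p \<bullet> (t *\<^sub>R p) = t"
    by simp
  have "2 * t * \<beta> + ln (\<eta> / (1 - \<eta>)) =
      ln (c * (1 - \<eta>) / (\<eta> * (1 - c))) + ln (\<eta> / (1 - \<eta>))"
    using beta_pos by (simp add: t_def)
  also have "\<dots> = ln (c / (1 - c))"
    using c eta by (simp add: ln_div ln_mult)
  \<comment> \<open>The witness \<open>z_out = 0\<close> is orthogonal to every vector, and
    \<open>t *\<^sub>R p\<close> has projection exactly \<open>t\<close> on the unit vector
    \<open>p\<close>.\<close>
  finally have "inv_posterior \<eta> \<mu>i \<sigma>i \<beta> (feature p 0 (t *\<^sub>R p)) = c"
    using c by (simp only: inv_posterior_feature_orthogonal orthogonal_clauses pt logistic_logit)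
  then show "\<exists>z_out z_e. orthogonal z_out \<mu>i \<and>
      p \<bullet> z_e = 1 / (2 * \<beta>) * ln (c * (1 - \<eta>) / (\<eta> * (1 - c))) \<and>
      inv_posterior \<eta> \<mu>i \<sigma>i \<beta> (feature p z_out z_e) = c"
    using pt unfolding t_def [symmetric]
    by (intro exI [of _ 0] exI [of _ "t *\<^sub>R p"]) (simp add: orthogonal_clauses)
qed

end
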